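(* Let $S(\mathbf{G}(V,E),\mathbf{M})$ be a constrained switching system with $\mathbf{M}\subset\mathbb{R}^{n\times n}$. Then $\hat\rho(S)=0$ if and only if $A_p=0$ for all paths $p$ in $\mathbf{G}$ of length $n|V|$.
   Context: A finite set of matrices $\mathbf{M}=\{A_1,\dots,A_N\}\subset\mathbb{R}^{n\times n}$ is given. $\mathbf{G}(V,E)$ is an automaton: a finite, directed, labeled, strongly connected graph with node set $V$ and edge set $E$; an edge is a triple $(v,w,\sigma)$ with source $v\in V$, destination $w\in V$ and label $\sigma\in\{1,\dots,N\}$. Strong connectivity is understood to guarantee that paths of arbitrary length exist (in particular $E\neq\emptyset$). No initial or final nodes are specified. A path is a sequence of consecutive edges; its length is its number of edges. For a path $p$ of length $T$ with successive edge labels $\sigma(1),\dots,\sigma(T)$, put $A_p=A_{\sigma(T)}\cdots A_{\sigma(1)}$. A sequence of labels is accepted by $\mathbf{G}$ if it is the sequence of labels along some path of $\mathbf{G}$. $|V|$ is the number of nodes. The constrained switching system $S(\mathbf{G},\mathbf{M})$ is $x_{t+1}=A_{\sigma(t)}x_t$, where $\sigma(0),\dots,\sigma(t)$ is accepted by $\mathbf{G}$. With $\|\cdot\|$ the matrix norm induced by the Euclidean norm, its constrained joint spectral radius is $$\hat\rho(S)=\lim_{t\to\infty}\max\left\{\|A_{\sigma(t-1)}\cdots A_{\sigma(0)}\|^{1/t}:\ \sigma(0),\dots,\sigma(t-1)\text{ is accepted by }\mathbf{G}\right\}.$$ *)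

theory Defs
  imports "HOL-Analysis.Analysis" "Graph_Theory.Digraph_Component" "Graph_Theory.Arc_Walk"
begin

type_synonym 'v edge = "'v \<times> 'v \<times> nat"

fun edge_source :: "'v edge \<Rightarrow> 'v" where "edge_source (v, w, \<sigma>) = v"
fun edge_dest :: "'v edge \<Rightarrow> 'v" where "edge_dest (v, w, \<sigma>) = w"
fun edge_label :: "'v edge \<Rightarrow> nat" where "edge_label (v, w, \<sigma>) = \<sigma>"

definition edge_graph :: "'v set \<Rightarrow> 'v edge set \<Rightarrow> ('v, 'v edge) pre_digraph" where
  "edge_graph V E = \<lparr>verts = V, arcs = E, tail = edge_source, head = edge_dest\<rparr>"

(* The library's strongly_connected holds for a single node without edges; since paths of every
   length are required to exist, that case is excluded by E \<noteq> {}. *)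
locale automaton =
  fixes V :: "'v set" and E :: "'v edge set" and N :: nat
  assumes finite_graph: "fin_digraph (edge_graph V E)"
    and strongly_connected: "strongly_connected (edge_graph V E)"
    and edges_nonempty: "E \<noteq> {}"
    and labels: "e \<in> E \<Longrightarrow> edge_label e \<in> {1..N}"

(* Nodes and edges may be repeated along a path, hence awalk and not apath. *)
definition path_in :: "'v set \<Rightarrow> 'v edge set \<Rightarrow> 'v edge list \<Rightarrow> bool" where
  "path_in V E p \<longleftrightarrow> (\<exists>u v. pre_digraph.awalk (edge_graph V E) u p v)"

definition accepted :: "'v set \<Rightarrow> 'v edge set \<Rightarrow> nat list \<Rightarrow> bool" where
  "accepted V E \<sigma>s \<longleftrightarrow> (\<exists>p. path_in V E p \<and> map edge_label p = \<sigma>s)"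

(* The first label of the list acts first, i.e. it is the rightmost factor. *)
primrec switch_prod :: "(nat \<Rightarrow> real^'n^'n) \<Rightarrow> nat list \<Rightarrow> real^'n^'n" where
  "switch_prod A [] = mat 1"
| "switch_prod A (\<sigma> # \<sigma>s) = switch_prod A \<sigma>s ** A \<sigma>"

definition path_prod :: "(nat \<Rightarrow> real^'n^'n) \<Rightarrow> 'v edge list \<Rightarrow> real^'n^'n" where
  "path_prod A p = switch_prod A (map edge_label p)"

(* The matrix norm induced by the Euclidean norm is onorm; the type class norm on real^'n^'n is
   the Frobenius norm. For an automaton the set under Max is finite and nonempty, and the limit
   exists by Fekete's lemma, because the maxima of the norms are submultiplicative in t. *)
definition cjsr :: "'v set \<Rightarrow> 'v edge set \<Rightarrow> (nat \<Rightarrow> real^'n^'n) \<Rightarrow> real" where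
  "cjsr V E A =
     lim (\<lambda>t. Max {root t (onorm ((*v) (switch_prod A \<sigma>s))) | \<sigma>s.
                     accepted V E \<sigma>s \<and> length \<sigma>s = t})"

end

theory Submission
  imports Defs
begin

text \<open>
  For a node \<open>v\<close> let \<open>K\<^sub>t(v)\<close> be the space of all vectors annihilated by \<open>A\<^sub>p\<close> for every path
  \<open>p\<close> of length \<open>t\<close> that starts in \<open>v\<close>. It is the kernel of the seminorm
  \<open>a\<^sub>t(v, x)\<close>, the sum of the \<open>\<parallel>A\<^sub>p x\<parallel>\<close> over these paths (\<open>path_sum\<close>), and it grows with \<open>t\<close>.
  The total dimension \<open>\<Sum>\<^sub>v dim K\<^sub>t(v)\<close> is at most \<open>n |V|\<close>, so it fails to increase in some step
  from \<open>t\<close> to \<open>t + 1\<close> with \<open>t \<le> n |V|\<close> (\<open>ex_kernels_stable\<close>).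

  At such a \<open>t\<close> the seminorms \<open>a\<^sub>t(v, \<cdot>)\<close> and \<open>a\<^sub>t\<^sub>+\<^sub>1(v, \<cdot>)\<close> have the same kernel for every \<open>v\<close>.
  In finite dimension this yields a single \<open>c > 0\<close> with \<open>a\<^sub>t\<^sub>+\<^sub>1 \<ge> c a\<^sub>t\<close> at all nodes
  (\<open>seminorm_dominates_of_kernel_subset\<close>). Splitting off the first edge of each path turns this one-step
  inequality into \<open>a\<^sub>t\<^sub>+\<^sub>s \<ge> c\<^sup>s a\<^sub>t\<close> (\<open>path_sum_growth\<close>). If some \<open>K\<^sub>t(v)\<close> were not the whole
  space, the products along paths would therefore decay at most exponentially and the constrained joint
  spectral radius would be positive (\<open>cjsr_pos_of_kernels_stable\<close>). So a vanishing
  radius forces \<open>K\<^sub>t(v) = \<real>\<^sup>n\<close> for all \<open>v\<close>, and all products of length \<open>t\<close>, hence those of length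
  \<open>n |V|\<close>, are zero.

  Conversely, if the products of some fixed length vanish, then so do all longer ones, and the sequence
  defining the radius is eventually zero. Both directions use that this sequence really converges to
  \<open>cjsr\<close>, which is Fekete's lemma for submultiplicative sequences
  (\<open>submultiplicative_root_convergent\<close>).
\<close>

section \<open>Submultiplicative sequences\<close>

lemma submultiplicative_power_le:
  fixes m :: "nat \<Rightarrow> real"
  assumes nonneg: "\<And>t. 0 \<le> m t"
    and submult: "\<And>s t. m (s + t) \<le> m s * m t"
  shows "m (k * q + s) \<le> m k ^ q * m s"
proof (induction q)
  case (Suc q)
  have "m (k * Suc q + s) = m (k + (k * q + s))" by (simp add: algebra_simps)
  also have "\<dots> \<le> m k * m (k * q + s)" by (rule submult)
  also have "\<dots> \<le> m k * (m k ^ q * m s)" by (intro mult_left_mono Suc.IH nonneg)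
  finally show ?case by (simp add: algebra_simps)
qed simp

text \<open>
  Fekete's lemma in multiplicative form; values \<open>0\<close> are allowed, so it is proved without logarithms.
  The limit is the infimum \<open>L\<close> of the roots. If \<open>root k (m k) < r\<close> for a single \<open>k\<close>, then division of
  \<open>t\<close> by \<open>k\<close> with remainder bounds \<open>m t\<close> by a constant times \<open>r ^ t\<close>, and the constant
  disappears under the \<open>t\<close>-th root.
\<close>

lemma submultiplicative_root_convergent:
  fixes m :: "nat \<Rightarrow> real"
  assumes nonneg: "\<And>t. 0 \<le> m t"
    and submult: "\<And>s t. m (s + t) \<le> m s * m t"
  shows "convergent (\<lambda>t. root t (m t))"
proof -
  define L where "L = (INF t\<in>{1..}. root t (m t))"
  have bdd: "bdd_below ((\<lambda>t. root t (m t)) ` {1..})"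
    by (rule bdd_belowI2[of _ 0]) (simp add: nonneg)
  have L_le: "L \<le> root t (m t)" if "t \<ge> 1" for t
    unfolding L_def using that by (intro cINF_lower bdd) auto
  have L_nonneg: "0 \<le> L"
    unfolding L_def by (rule cINF_greatest) (auto simp: nonneg)
  have "(\<lambda>t. root t (m t)) \<longlonglongrightarrow> L"
  proof (rule order_tendstoI)
    fix a assume "a < L"
    then show "\<forall>\<^sub>F t in sequentially. a < root t (m t)"
      using L_le by (intro eventually_sequentiallyI[of 1]) force
  next
    fix u assume "L < u"
    then obtain r where r: "L < r" "r < u" using dense by blast
    then have "r > 0" using L_nonneg by simp
    obtain k where k: "k \<ge> 1" "root k (m k) < r"
      using r(1) unfolding L_def by (subst (asm) cINF_less_iff[OF _ bdd]) auto
    have "m k = root k (m k) ^ k" using k nonneg by simp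
    also have "\<dots> \<le> r ^ k" using k nonneg by (intro power_mono) auto
    finally have mk: "m k \<le> r ^ k" .
    \<comment> \<open>\<open>D\<close> dominates \<open>m s / r ^ s\<close> for every possible remainder \<open>s\<close>; the \<open>1\<close> makes it positive.\<close>
    define D where "D = 1 + (\<Sum>s<k. m s / r ^ s)"
    have "0 \<le> (\<Sum>s<k. m s / r ^ s)" using nonneg \<open>r > 0\<close> by (intro sum_nonneg) auto
    then have "D > 0" by (simp add: D_def)
    have bound: "m t \<le> D * r ^ t" for t
    proof -
      define q s where "q = t div k" and "s = t mod k"
      have t: "t = k * q + s" and s: "s < k" using k by (auto simp: q_def s_def)
      have "m s / r ^ s \<le> (\<Sum>s<k. m s / r ^ s)"
        using s nonneg \<open>r > 0\<close> by (intro member_le_sum) auto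
      then have ms: "m s \<le> D * r ^ s"
        using \<open>r > 0\<close> by (simp add: D_def field_simps add_increasing)
      have "m t \<le> m k ^ q * m s"
        unfolding t by (intro submultiplicative_power_le nonneg submult)
      also have "\<dots> \<le> (r ^ k) ^ q * (D * r ^ s)"
        using mk ms nonneg \<open>r > 0\<close> by (intro mult_mono power_mono) auto
      also have "\<dots> = D * r ^ t" by (simp add: t power_add power_mult)
      finally show ?thesis .
    qed
    have "(\<lambda>t. root t D * r) \<longlonglongrightarrow> 1 * r"
      using \<open>D > 0\<close> by (intro tendsto_mult LIMSEQ_root_const tendsto_const)
    then have "\<forall>\<^sub>F t in sequentially. root t D * r < u"
      using r(2) by (intro order_tendstoD(2)) auto
    then show "\<forall>\<^sub>F t in sequentially. root t (m t) < u"
      using eventually_gt_at_top[of 0]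
    proof eventually_elim
      case (elim t)
      have "root t (m t) \<le> root t (D * r ^ t)"
        using elim bound by (intro real_root_le_mono) auto
      also have "\<dots> = root t D * r"
        using elim \<open>r > 0\<close> by (simp add: real_root_mult real_root_power_cancel)
      finally show ?case using elim by simp
    qed
  qed
  then show ?thesis by (rule convergentI)
qed

lemma exponential_lower_bound_root_limit:
  fixes m :: "nat \<Rightarrow> real"
  assumes lim: "(\<lambda>t. root t (m t)) \<longlonglongrightarrow> L"
    and "0 < d" "0 < c"
    and bound: "\<And>t. d * c ^ t \<le> m (k + t)"
  shows "0 < L"
proof -
  \<comment> \<open>Rewriting the bound in terms of \<open>k + t\<close> costs the factor \<open>c ^ k\<close>.\<close>
  define d' where "d' = d / c ^ k"
  have "d' > 0" using assms by (simp add: d'_def)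
  have "(\<lambda>t. root t d' * c) \<longlonglongrightarrow> 1 * c"
    using \<open>d' > 0\<close> by (intro tendsto_mult LIMSEQ_root_const tendsto_const)
  then have "1 * c \<le> L"
  proof (rule LIMSEQ_le[OF _ lim])
    show "\<exists>N. \<forall>t\<ge>N. root t d' * c \<le> root t (m t)"
    proof (intro exI[of _ "Suc k"] allI impI)
      fix t assume t: "t \<ge> Suc k"
      have "root t d' * c = root t (d' * c ^ t)"
        using t \<open>0 < c\<close> by (simp add: real_root_mult real_root_power_cancel)
      also have "\<dots> \<le> root t (m t)"
      proof (rule real_root_le_mono)
        have "d' * c ^ t = d * c ^ (t - k)"
          using t \<open>0 < c\<close> by (simp add: d'_def power_diff)
        then show "d' * c ^ t \<le> m t" using bound[of "t - k"] t by simp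
      qed (use t in auto)
      finally show "root t d' * c \<le> root t (m t)" .
    qed
  qed
  with \<open>0 < c\<close> show ?thesis by simp
qed

section \<open>Comparison of seminorms\<close>

definition seminorm :: "('a::real_vector \<Rightarrow> real) \<Rightarrow> bool" where
  "seminorm p \<longleftrightarrow> (\<forall>x y. p (x + y) \<le> p x + p y) \<and> (\<forall>c x. p (c *\<^sub>R x) = \<bar>c\<bar> * p x)"

lemma seminorm_add: "seminorm p \<Longrightarrow> p (x + y) \<le> p x + p y"
  and seminorm_scaleR: "seminorm p \<Longrightarrow> p (c *\<^sub>R x) = \<bar>c\<bar> * p x"
  by (auto simp: seminorm_def)

lemma seminorm_zero: "seminorm p \<Longrightarrow> p 0 = 0"
  using seminorm_scaleR[of p 0 0] by simp

lemma seminorm_nonneg: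
  assumes "seminorm p"
  shows "0 \<le> p x"
  using seminorm_add[OF assms, of x "- x"] seminorm_scaleR[OF assms, of "-1" x]
  by (simp add: seminorm_zero[OF assms])

lemma seminorm_norm: "seminorm norm"
  by (simp add: seminorm_def norm_triangle_ineq)

lemma seminorm_linear_compose: "seminorm p \<Longrightarrow> linear f \<Longrightarrow> seminorm (\<lambda>x. p (f x))"
  by (simp add: seminorm_def linear_add linear_scale)

lemma seminorm_sum:
  assumes "\<And>i. i \<in> I \<Longrightarrow> seminorm (p i)"
  shows "seminorm (\<lambda>x. \<Sum>i\<in>I. p i x)"
  unfolding seminorm_def sum.distrib[symmetric] sum_distrib_left
  using assms by (auto intro!: sum_mono sum.cong simp: seminorm_add seminorm_scaleR)

lemma seminorm_subspace_kernel:
  assumes "seminorm p"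
  shows "subspace {x. p x = 0}"
proof (rule subspaceI)
  fix x y assume "x \<in> {x. p x = 0}" "y \<in> {x. p x = 0}"
  then show "x + y \<in> {x. p x = 0}"
    using seminorm_add[OF assms, of x y] seminorm_nonneg[OF assms, of "x + y"] by simp
qed (auto simp: seminorm_zero[OF assms] seminorm_scaleR[OF assms])

lemma seminorm_continuous_on:
  fixes p :: "'a::euclidean_space \<Rightarrow> real"
  assumes "seminorm p"
  shows "continuous_on S p"
proof -
  have "convex_on UNIV p"
  proof (rule convex_onI)
    fix t :: real and x y :: 'a assume "0 < t" "t < 1"
    then show "p ((1 - t) *\<^sub>R x + t *\<^sub>R y) \<le> (1 - t) * p x + t * p y"
      using seminorm_add[OF assms, of "(1 - t) *\<^sub>R x" "t *\<^sub>R y"]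
      by (simp add: seminorm_scaleR[OF assms])
  qed simp
  then have "continuous_on UNIV p" by (intro convex_on_continuous) auto
  then show ?thesis by (rule continuous_on_subset) simp
qed

text \<open>
  On the unit sphere of the orthogonal complement of the kernel of \<open>q\<close>, which is compact, \<open>q\<close> is
  positive and so \<open>p / q\<close> is bounded. Removing the component of a vector inside the kernel of \<open>q\<close>
  changes neither seminorm, because \<open>p\<close> vanishes there as well.
\<close>

lemma seminorm_dominates_of_kernel_subset:
  fixes p q :: "'a::euclidean_space \<Rightarrow> real"
  assumes p: "seminorm p" and q: "seminorm q"
    and ker: "\<And>x. q x = 0 \<Longrightarrow> p x = 0"
  shows "\<exists>c>0. \<forall>x. c * p x \<le> q x"
proof -
  define S where "S = {x. q x = 0}"
  have S: "subspace S" unfolding S_def by (rule seminorm_subspace_kernel[OF q])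
  define T where "T = sphere 0 1 \<inter> {z. \<forall>s\<in>S. orthogonal s z}"
  have q_pos: "q z > 0" if "z \<in> T" for z
  proof (rule ccontr)
    assume "\<not> q z > 0"
    then have "z \<in> S" using seminorm_nonneg[OF q, of z] by (simp add: S_def)
    then show False using that by (auto simp: T_def orthogonal_self)
  qed
  have "closed {z. \<forall>s\<in>S. orthogonal s z}"
    by (intro closed_subspace subspace_orthogonal_to_vectors)
  then have "compact T" unfolding T_def by (intro compact_Int_closed) auto
  then have "compact ((\<lambda>z. p z / q z) ` T)"
    by (intro compact_continuous_image continuous_on_divide seminorm_continuous_on[OF p]
        seminorm_continuous_on[OF q] ballI less_imp_neq[symmetric] q_pos)
  then have "bounded ((\<lambda>z. p z / q z) ` T)" by (rule compact_imp_bounded)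
  then obtain C where "C > 0" and bound: "\<forall>y\<in>(\<lambda>z. p z / q z) ` T. norm y \<le> C"
    unfolding bounded_pos by blast
  have C: "p z / q z \<le> C" if "z \<in> T" for z
    using bound[THEN bspec, OF imageI[OF that]] unfolding real_norm_def by linarith
  have "p x \<le> C * q x" for x
  proof -
    obtain y z where y: "y \<in> span S" and z: "\<And>w. w \<in> span S \<Longrightarrow> orthogonal z w"
      and x: "x = y + z"
      using orthogonal_subspace_decomp_exists[of S x] by metis
    have "y \<in> S" using y S by (metis span_eq_iff)
    then have "q y = 0" by (simp add: S_def)
    then have "p y = 0" by (rule ker)
    \<comment> \<open>Needed for \<open>q z \<le> q x\<close>, as \<open>z = x + (- y)\<close>.\<close>
    have "q (- y) = 0" using seminorm_scaleR[OF q, of "-1" y] \<open>q y = 0\<close> by simp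
    have pz: "p z \<le> C * q z"
    proof (cases "z = 0")
      case True
      then show ?thesis by (simp add: seminorm_zero[OF p] seminorm_zero[OF q])
    next
      case False
      define z' where "z' = (1 / norm z) *\<^sub>R z"
      have "z' \<in> T"
        using z False
        by (auto simp: T_def z'_def orthogonal_commute orthogonal_clauses span_base)
      then have "p z' \<le> C * q z'"
        using C[of z'] q_pos[of z'] by (simp add: field_simps)
      then show ?thesis
        using False by (simp add: z'_def seminorm_scaleR[OF p] seminorm_scaleR[OF q] field_simps)
    qed
    have "p x \<le> p z" using seminorm_add[OF p, of y z] \<open>p y = 0\<close> x by simp
    also have "\<dots> \<le> C * q z" by (rule pz)
    also have "\<dots> \<le> C * q x"
      using seminorm_add[OF q, of x "- y"] \<open>q (- y) = 0\<close> x \<open>C > 0\<close> by simp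
    finally show ?thesis .
  qed
  then show ?thesis using \<open>C > 0\<close> by (intro exI[of _ "1 / C"]) (simp add: field_simps)
qed

section \<open>Products along words\<close>

lemma switch_prod_append:
  "switch_prod A (xs @ ys) = switch_prod A ys ** switch_prod A xs"
  by (induction xs) (simp_all add: matrix_mul_assoc)

lemma onorm_switch_prod_nonneg:
  "0 \<le> onorm ((*v) (switch_prod (A :: nat \<Rightarrow> real^'n^'n) w))"
  by (intro onorm_pos_le matrix_vector_mul_bounded_linear)

lemma onorm_switch_prod_append:
  fixes A :: "nat \<Rightarrow> real^'n^'n"
  shows "onorm ((*v) (switch_prod A (xs @ ys)))
    \<le> onorm ((*v) (switch_prod A xs)) * onorm ((*v) (switch_prod A ys))"
proof -
  have "(*v) (switch_prod A (xs @ ys)) = (*v) (switch_prod A ys) \<circ> (*v) (switch_prod A xs)"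
    by (auto simp: switch_prod_append matrix_vector_mul_assoc)
  then show ?thesis
    using onorm_compose[OF matrix_vector_mul_bounded_linear matrix_vector_mul_bounded_linear,
        of "switch_prod A ys" "switch_prod A xs"]
    by (simp add: mult.commute)
qed

section \<open>Paths in an automaton\<close>

context automaton
begin

sublocale graph: fin_digraph "edge_graph V E"
  by (rule finite_graph)

\<comment> \<open>As an elimination rule it destroys walk hypotheses that are still to be matched with a goal.\<close>
declare graph.awalkE [rule del]

lemma edge_graph_simps [simp]:
  "verts (edge_graph V E) = V" "arcs (edge_graph V E) = E"
  "tail (edge_graph V E) = edge_source" "head (edge_graph V E) = edge_dest"
  by (simp_all add: edge_graph_def)

lemma finite_V: "finite V" and finite_E: "finite E"
  using graph.finite_verts graph.finite_arcs by simp_all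

lemma edge_dest_in_V: "e \<in> E \<Longrightarrow> edge_dest e \<in> V"
  using graph.head_in_verts by simp

lemma path_in_append: "path_in V E (p @ q) \<Longrightarrow> path_in V E p \<and> path_in V E q"
  unfolding path_in_def graph.awalk_append_iff by blast

lemma accepted_append:
  assumes "accepted V E (xs @ ys)"
  shows "accepted V E xs" "accepted V E ys"
proof -
  obtain p where "path_in V E p" "map edge_label p = xs @ ys"
    using assms by (auto simp: accepted_def)
  then show "accepted V E xs" "accepted V E ys"
    by (auto simp: accepted_def map_eq_append_conv dest!: path_in_append)
qed

text \<open>
  A walk to the source of some edge either is empty, in which case that edge itself leaves \<open>v\<close>, or it
  begins with an edge leaving \<open>v\<close>. Consequently walks never get stuck, so there are accepted words
  of every length and the maxima in the definition of the radius range over nonempty sets.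
\<close>

lemma ex_outgoing_edge:
  assumes "v \<in> V"
  shows "\<exists>e\<in>E. edge_source e = v"
proof -
  obtain e where e: "e \<in> E" using edges_nonempty by blast
  then have "edge_source e \<in> V" using graph.tail_in_verts by simp
  then have "v \<rightarrow>\<^sup>*\<^bsub>edge_graph V E\<^esub> edge_source e"
    using strongly_connected assms by (auto simp: strongly_connected_def)
  then obtain p where "graph.awalk v p (edge_source e)"
    using graph.reachable_awalk by blast
  then show ?thesis
    using e by (cases p) (auto simp: graph.awalk_simps)
qed

lemma ex_walk_of_length:
  "v \<in> V \<Longrightarrow> \<exists>p u. graph.awalk v p u \<and> length p = t"
proof (induction t arbitrary: v)
  case 0
  then show ?case by (auto simp: graph.awalk_simps)
next
  case (Suc t)
  obtain e where e: "e \<in> E" "edge_source e = v" using ex_outgoing_edge Suc.prems by blast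
  obtain p u where "graph.awalk (edge_dest e) p u" "length p = t"
    using Suc.IH edge_dest_in_V e by blast
  then show ?case
    using e by (intro exI[of _ "e # p"] exI[of _ u]) (auto simp: graph.awalk_simps)
qed

lemma path_in_iff: "path_in V E p \<longleftrightarrow> (\<exists>v\<in>V. \<exists>u. graph.awalk v p u)"
  unfolding path_in_def using graph.awalk_hd_in_verts by auto

lemma V_nonempty: "V \<noteq> {}"
  using strongly_connected by (simp add: strongly_connected_def)

abbreviation accepted_words :: "nat \<Rightarrow> nat list set" where
  "accepted_words t \<equiv> {w. accepted V E w \<and> length w = t}"

lemma finite_accepted_words: "finite (accepted_words t)"
proof (rule finite_subset)
  show "accepted_words t \<subseteq> {w. set w \<subseteq> edge_label ` E \<and> length w = t}"
    by (auto simp: accepted_def path_in_def graph.awalk_def subset_iff simp del: edge_label.simps)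
  show "finite {w. set w \<subseteq> edge_label ` E \<and> length w = t}"
    by (intro finite_lists_length_eq finite_imageI finite_E)
qed

lemma accepted_words_nonempty: "accepted_words t \<noteq> {}"
proof -
  obtain p where "path_in V E p" "length p = t"
    using V_nonempty ex_walk_of_length path_in_iff by blast
  then have "map edge_label p \<in> accepted_words t" by (auto simp: accepted_def)
  then show ?thesis by blast
qed

section \<open>The constrained joint spectral radius as a limit\<close>

definition max_norm :: "(nat \<Rightarrow> real^'n^'n) \<Rightarrow> nat \<Rightarrow> real" where
  "max_norm A t = Max ((\<lambda>w. onorm ((*v) (switch_prod A w))) ` accepted_words t)"

lemma onorm_le_max_norm:
  "w \<in> accepted_words t \<Longrightarrow> onorm ((*v) (switch_prod A w)) \<le> max_norm A t"
  unfolding max_norm_def by (intro Max_ge finite_imageI finite_accepted_words imageI)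

lemma max_norm_le:
  assumes "\<And>w. w \<in> accepted_words t \<Longrightarrow> onorm ((*v) (switch_prod A w)) \<le> b"
  shows "max_norm A t \<le> b"
  unfolding max_norm_def
  using assms accepted_words_nonempty by (subst Max_le_iff) (auto simp: finite_accepted_words)

lemma max_norm_nonneg: "0 \<le> max_norm A t"
proof -
  obtain w where "w \<in> accepted_words t" using accepted_words_nonempty by blast
  from onorm_switch_prod_nonneg onorm_le_max_norm[OF this] show ?thesis by (rule order_trans)
qed

text \<open>
  Each piece of an accepted word is accepted, since no initial or final nodes are prescribed.
\<close>

lemma max_norm_submultiplicative: "max_norm A (s + t) \<le> max_norm A s * max_norm A t"
proof (rule max_norm_le)
  fix w assume w: "w \<in> accepted_words (s + t)"
  then obtain xs ys where w_eq: "w = xs @ ys" and len: "length xs = s" "length ys = t"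
    using that[of "take s w" "drop s w"] by simp
  with w have xs: "xs \<in> accepted_words s" and ys: "ys \<in> accepted_words t"
    using accepted_append[of xs ys] by auto
  have "onorm ((*v) (switch_prod A w))
      \<le> onorm ((*v) (switch_prod A xs)) * onorm ((*v) (switch_prod A ys))"
    unfolding w_eq by (rule onorm_switch_prod_append)
  also have "\<dots> \<le> max_norm A s * max_norm A t"
    using xs ys by (intro mult_mono onorm_le_max_norm onorm_switch_prod_nonneg max_norm_nonneg)
  finally show "onorm ((*v) (switch_prod A w)) \<le> max_norm A s * max_norm A t" .
qed

text \<open>
  The root is monotone, so it may be taken after the maximum. This includes \<open>t = 0\<close>, where
  \<open>root 0\<close> is constantly \<open>0\<close>.
\<close>

lemma Max_root_onorm_eq:
  "Max {root t (onorm ((*v) (switch_prod A w))) | w. accepted V E w \<and> length w = t}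
    = root t (max_norm A t)"
proof -
  have "mono (root t)"
    by (intro monoI, cases "t = 0") (simp_all add: real_root_le_mono)
  then have "root t (max_norm A t)
      = Max (root t ` (\<lambda>w. onorm ((*v) (switch_prod A w))) ` accepted_words t)"
    unfolding max_norm_def
    using accepted_words_nonempty finite_accepted_words by (intro mono_Max_commute) auto
  also have "root t ` (\<lambda>w. onorm ((*v) (switch_prod A w))) ` accepted_words t
      = {root t (onorm ((*v) (switch_prod A w))) | w. accepted V E w \<and> length w = t}"
    by auto
  finally show ?thesis by simp
qed

lemma cjsr_eq_lim: "cjsr V E A = lim (\<lambda>t. root t (max_norm A t))"
  unfolding cjsr_def Max_root_onorm_eq ..

lemma cjsr_limit: "(\<lambda>t. root t (max_norm A t)) \<longlonglongrightarrow> cjsr V E A"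
  unfolding cjsr_eq_lim
  by (intro convergent_LIMSEQ_iff[THEN iffD1] submultiplicative_root_convergent
      max_norm_nonneg max_norm_submultiplicative)

section \<open>Sums over the paths leaving a node\<close>

text \<open>
  The sum of \<open>norm (A\<^sub>p x)\<close> over all paths \<open>p\<close> of length \<open>t\<close> that start in \<open>v\<close>. The recursion splits
  off the first edge, which is the one whose matrix acts first, and so the growth argument becomes an
  induction over sums of edges.
\<close>

primrec path_sum :: "(nat \<Rightarrow> real^'n^'n) \<Rightarrow> nat \<Rightarrow> 'v \<Rightarrow> real^'n \<Rightarrow> real" where
  "path_sum A 0 v x = norm x"
| "path_sum A (Suc t) v x =
    (\<Sum>e\<in>{e \<in> E. edge_source e = v}. path_sum A t (edge_dest e) (A (edge_label e) *v x))"

lemma seminorm_path_sum: "seminorm (path_sum A t v)"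
proof (induction t arbitrary: v)
  case 0
  then show ?case using seminorm_norm by (simp add: seminorm_def)
next
  case (Suc t)
  have "seminorm (\<lambda>x. path_sum A (Suc t) v x)"
    unfolding path_sum.simps
    by (intro seminorm_sum seminorm_linear_compose[OF Suc.IH] matrix_vector_mul_linear)
  then show ?case by simp
qed

lemmas path_sum_nonneg = seminorm_nonneg[OF seminorm_path_sum]

lemma norm_path_prod_le_path_sum:
  "graph.awalk v p u \<Longrightarrow> norm (path_prod A p *v x) \<le> path_sum A (length p) v x"
proof (induction p arbitrary: v x)
  case Nil
  then show ?case by (simp add: path_prod_def)
next
  case (Cons e p)
  then have e: "e \<in> E" "edge_source e = v" and p: "graph.awalk (edge_dest e) p u"
    by (auto simp: graph.awalk_simps)
  have "norm (path_prod A (e # p) *v x) = norm (path_prod A p *v (A (edge_label e) *v x))"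
    by (simp add: path_prod_def matrix_vector_mul_assoc)
  also have "\<dots> \<le> path_sum A (length p) (edge_dest e) (A (edge_label e) *v x)"
    by (rule Cons.IH[OF p])
  also have "\<dots> \<le> path_sum A (length (e # p)) v x"
    using e finite_E
    by (simp add: member_le_sum path_sum_nonneg
        member_le_sum[of e _ "\<lambda>e. path_sum A (length p) (edge_dest e) (A (edge_label e) *v x)"])
  finally show ?case .
qed

text \<open>
  There are at most \<open>card E ^ t\<close> paths of length \<open>t\<close> leaving a node. Multiplying by this number
  changes only the exponential rate, not whether it is positive.
\<close>

lemma path_sum_le:
  assumes "v \<in> V" "0 \<le> b"
    and "\<And>p u. graph.awalk v p u \<Longrightarrow> length p = t \<Longrightarrow> norm (path_prod A p *v x) \<le> b"
  shows "path_sum A t v x \<le> real (card E) ^ t * b"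
  using assms
proof (induction t arbitrary: v x)
  case 0
  show ?case using "0.prems"(3)[of "[]" v] "0.prems"(1) by (simp add: graph.awalk_simps path_prod_def)
next
  case (Suc t)
  let ?out = "{e \<in> E. edge_source e = v}"
  have "path_sum A t (edge_dest e) (A (edge_label e) *v x) \<le> real (card E) ^ t * b"
    if e: "e \<in> ?out" for e
  proof (rule Suc.IH)
    show "edge_dest e \<in> V" using e edge_dest_in_V by simp
    fix p u assume "graph.awalk (edge_dest e) p u" "length p = t"
    then have "norm (path_prod A (e # p) *v x) \<le> b"
      using e by (intro Suc.prems(3)) (auto simp: graph.awalk_simps)
    then show "norm (path_prod A p *v (A (edge_label e) *v x)) \<le> b"
      by (simp add: path_prod_def matrix_vector_mul_assoc)
  qed (rule Suc.prems)
  then have "path_sum A (Suc t) v x \<le> real (card ?out) * (real (card E) ^ t * b)"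
    unfolding path_sum.simps by (rule sum_bounded_above)
  also have "\<dots> \<le> real (card E) * (real (card E) ^ t * b)"
    using Suc.prems(2) finite_E by (intro mult_right_mono) (auto intro: card_mono)
  finally show ?case by simp
qed

lemma path_sum_le_max_norm:
  assumes "v \<in> V"
  shows "path_sum A t v x \<le> real (card E) ^ t * (max_norm A t * norm x)"
proof (rule path_sum_le[OF assms])
  show "0 \<le> max_norm A t * norm x" by (simp add: max_norm_nonneg)
  fix p u assume p: "graph.awalk v p u" "length p = t"
  then have "map edge_label p \<in> accepted_words t" by (auto simp: accepted_def path_in_def)
  then have "onorm ((*v) (path_prod A p)) \<le> max_norm A t"
    unfolding path_prod_def by (rule onorm_le_max_norm)
  then show "norm (path_prod A p *v x) \<le> max_norm A t * norm x"
    by (meson onorm matrix_vector_mul_bounded_linear mult_right_mono norm_ge_zero order_trans)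
qed

section \<open>The growing kernels\<close>

text \<open>
  A path of length \<open>t + 1\<close> extends a path of length \<open>t\<close> from the same node, and the product along the
  latter already annihilates \<open>x\<close>.
\<close>

lemma path_sum_eq_0_Suc: "path_sum A t v x = 0 \<Longrightarrow> path_sum A (Suc t) v x = 0"
proof (induction t arbitrary: v x)
  case (Suc t)
  have "\<forall>e\<in>{e \<in> E. edge_source e = v}.
      path_sum A t (edge_dest e) (A (edge_label e) *v x) = 0"
    using Suc.prems finite_E
    by (subst sum_nonneg_eq_0_iff[symmetric]) (simp_all add: path_sum_nonneg)
  then show ?case
    unfolding path_sum.simps(2)[of A "Suc t"] by (intro sum.neutral ballI Suc.IH) auto
qed simp

lemma path_sum_eq_0_mono:
  "s \<le> t \<Longrightarrow> path_sum A s v x = 0 \<Longrightarrow> path_sum A t v x = 0"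
  by (induction t rule: dec_induct) (auto intro: path_sum_eq_0_Suc simp del: path_sum.simps)

text \<open>
  Otherwise the total dimension of the kernels would increase in each of the \<open>n |V| + 1\<close> steps starting
  from \<open>t = 0\<close>, \<open>1\<close>, ..., \<open>n |V|\<close>, and would end up larger than \<open>n |V|\<close>.
\<close>

lemma ex_kernels_stable:
  fixes A :: "nat \<Rightarrow> real^'n^'n"
  shows "\<exists>t\<le>CARD('n) * card V. \<forall>v\<in>V. \<forall>x.
    path_sum A (Suc t) v x = 0 \<longrightarrow> path_sum A t v x = 0"
proof (rule ccontr)
  assume "\<not> ?thesis"
  then have ex: "\<exists>v\<in>V. \<exists>x. path_sum A (Suc t) v x = 0 \<and> path_sum A t v x \<noteq> 0"
    if "t \<le> CARD('n) * card V" for t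
    using that by blast
  define K where "K t v = {x. path_sum A t v x = 0}" for t v
  define d where "d t = (\<Sum>v\<in>V. dim (K t v))" for t
  have sub: "subspace (K t v)" for t v
    unfolding K_def by (rule seminorm_subspace_kernel[OF seminorm_path_sum])
  have mono: "K t v \<subseteq> K (Suc t) v" for t v
    unfolding K_def using path_sum_eq_0_Suc by blast
  have step: "d t < d (Suc t)" if t: "t \<le> CARD('n) * card V" for t
    unfolding d_def
  proof (rule sum_strict_mono_ex1[OF finite_V])
    show "\<forall>v\<in>V. dim (K t v) \<le> dim (K (Suc t) v)" using mono dim_subset by blast
    obtain v where v: "v \<in> V" "K t v \<noteq> K (Suc t) v" using ex[OF t] by (auto simp: K_def)
    then have "dim (K t v) < dim (K (Suc t) v)"
      using subspace_dim_equal[OF sub sub mono] by (meson not_le)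
    then show "\<exists>v\<in>V. dim (K t v) < dim (K (Suc t) v)" using v by blast
  qed
  have "t \<le> d t" if "t \<le> Suc (CARD('n) * card V)" for t
    using that
  proof (induction t)
    case (Suc t)
    then show ?case using step[of t] by simp
  qed simp
  then have "Suc (CARD('n) * card V) \<le> d (Suc (CARD('n) * card V))" by blast
  also have "\<dots> \<le> card V * CARD('n)"
    unfolding d_def using sum_bounded_above[of V _ "CARD('n)"] dim_subset_UNIV_cart[where 'n = 'n]
    by simp
  finally show False by (simp add: mult.commute)
qed

text \<open>
  Equality of kernels gives a factor for each node, and the least of them serves all nodes at once.
  With the same factor at the end of every first edge, induction on \<open>s\<close> can sum the bounds over these
  edges.
\<close>

lemma path_sum_growth:
  assumes stable: "\<And>v x. v \<in> V \<Longrightarrow> path_sum A (Suc t) v x = 0 \<Longrightarrow> path_sum A t v x = 0"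
  shows "\<exists>c>0. \<forall>s. \<forall>v\<in>V. \<forall>x. c ^ s * path_sum A t v x \<le> path_sum A (t + s) v x"
proof -
  have "\<exists>c>0. \<forall>x. c * path_sum A t v x \<le> path_sum A (Suc t) v x" if "v \<in> V" for v
    using that stable by (intro seminorm_dominates_of_kernel_subset seminorm_path_sum) blast
  then obtain c where c: "\<And>v. v \<in> V \<Longrightarrow> c v > 0"
    "\<And>v x. v \<in> V \<Longrightarrow> c v * path_sum A t v x \<le> path_sum A (Suc t) v x"
    by metis
  define c0 where "c0 = Min (c ` V)"
  have "c0 > 0" unfolding c0_def using c(1) finite_V V_nonempty by simp
  have c0: "c0 * path_sum A t v x \<le> path_sum A (Suc t) v x" if "v \<in> V" for v x
  proof -
    have "c0 \<le> c v" unfolding c0_def using that finite_V by simp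
    then have "c0 * path_sum A t v x \<le> c v * path_sum A t v x"
      by (intro mult_right_mono path_sum_nonneg)
    then show ?thesis using c(2)[OF that, of x] by linarith
  qed
  have "c0 ^ s * path_sum A t v x \<le> path_sum A (t + s) v x" if "v \<in> V" for s v x
    using that
  proof (induction s arbitrary: v x)
    case (Suc s)
    have "c0 ^ Suc s * path_sum A t v x = c0 ^ s * (c0 * path_sum A t v x)" by simp
    also have "\<dots> \<le> c0 ^ s * path_sum A (Suc t) v x"
      using c0[OF Suc.prems] \<open>c0 > 0\<close> by (intro mult_left_mono) auto
    also have "\<dots> = (\<Sum>e\<in>{e \<in> E. edge_source e = v}.
        c0 ^ s * path_sum A t (edge_dest e) (A (edge_label e) *v x))"
      by (simp add: sum_distrib_left)
    also have "\<dots> \<le> path_sum A (t + Suc s) v x"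
      unfolding add_Suc_right path_sum.simps by (intro sum_mono Suc.IH) (auto intro: edge_dest_in_V)
    finally show ?case .
  qed simp
  with \<open>c0 > 0\<close> show ?thesis by blast
qed

text \<open>
  The path sums grow at least like \<open>c ^ s\<close>, while there are at most \<open>(card E) ^ (t + s)\<close> summands; so the
  largest of them is at least of the order \<open>(c / card E) ^ s\<close>.
\<close>

lemma cjsr_pos_of_kernels_stable:
  assumes stable: "\<And>v x. v \<in> V \<Longrightarrow> path_sum A (Suc t) v x = 0 \<Longrightarrow> path_sum A t v x = 0"
    and "v \<in> V" "path_sum A t v x \<noteq> 0"
  shows "0 < cjsr V E A"
proof -
  obtain c where "c > 0" and c: "\<And>s v x. v \<in> V \<Longrightarrow> c ^ s * path_sum A t v x \<le> path_sum A (t + s) v x"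
    using path_sum_growth[OF stable] by blast
  define k where "k = real (card E)"
  have "k > 0" using finite_E edges_nonempty by (simp add: k_def card_gt_0_iff)
  have a: "path_sum A t v x > 0" using assms(3) path_sum_nonneg[of A t v x] by linarith
  have "x \<noteq> 0" using assms(3) seminorm_zero[OF seminorm_path_sum, of A t v] by auto
  define d where "d = path_sum A t v x / (k ^ t * norm x)"
  show ?thesis
  proof (rule exponential_lower_bound_root_limit[OF cjsr_limit])
    show "d > 0" unfolding d_def using a \<open>k > 0\<close> \<open>x \<noteq> 0\<close> by simp
    show "c / k > 0" using \<open>c > 0\<close> \<open>k > 0\<close> by simp
    fix s
    have "c ^ s * path_sum A t v x \<le> k ^ (t + s) * (max_norm A (t + s) * norm x)"
      using c[OF \<open>v \<in> V\<close>] path_sum_le_max_norm[OF \<open>v \<in> V\<close>] unfolding k_def by (rule order_trans)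
    then show "d * (c / k) ^ s \<le> max_norm A (t + s)"
      using \<open>k > 0\<close> \<open>x \<noteq> 0\<close> by (simp add: d_def field_simps power_add)
  qed
qed

lemma path_prod_eq_0_of_cjsr_eq_0:
  fixes A :: "nat \<Rightarrow> real^'n^'n"
  assumes "cjsr V E A = 0" and p: "path_in V E p" "length p = CARD('n) * card V"
  shows "path_prod A p = 0"
proof -
  obtain t where t: "t \<le> CARD('n) * card V"
    and stable: "\<And>v x. v \<in> V \<Longrightarrow> path_sum A (Suc t) v x = 0 \<Longrightarrow> path_sum A t v x = 0"
    using ex_kernels_stable[of A] by blast
  have vanish: "path_sum A t v x = 0" if "v \<in> V" for v x
    using cjsr_pos_of_kernels_stable[of A t, OF stable that] assms(1) by fastforce
  obtain v u where v: "v \<in> V" "graph.awalk v p u" using p(1) path_in_iff by blast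
  have "path_prod A p *v x = 0" for x
    using norm_path_prod_le_path_sum[OF v(2), of A x]
      path_sum_eq_0_mono[OF t vanish[OF v(1)], of x] p(2) by simp
  then show ?thesis by (simp add: matrix_eq)
qed

text \<open>
  The first \<open>T\<close> edges of a longer path form a path, and their product is a right factor of the whole
  product.
\<close>

lemma cjsr_eq_0_of_path_prod_eq_0:
  assumes zero: "\<And>p. path_in V E p \<Longrightarrow> length p = T \<Longrightarrow> path_prod A p = 0"
  shows "cjsr V E A = 0"
proof -
  have "max_norm A t = 0" if "t \<ge> T" for t
  proof (rule antisym[OF max_norm_le max_norm_nonneg])
    fix w assume "w \<in> accepted_words t"
    then obtain p where p: "path_in V E p" "w = map edge_label p" "length p = t"
      by (auto simp: accepted_def)
    have "path_in V E (take T p)" using path_in_append[of "take T p" "drop T p"] p(1) by simp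
    then have "switch_prod A (take T w) = 0"
      using zero[of "take T p"] p that by (simp add: path_prod_def take_map)
    then have "switch_prod A w = 0"
      using switch_prod_append[of A "take T w" "drop T w"] by simp
    then have "(*v) (switch_prod A w) = (\<lambda>x. 0)" by auto
    then show "onorm ((*v) (switch_prod A w)) \<le> 0" by (simp add: onorm_zero)
  qed
  then have "\<forall>\<^sub>F t in sequentially. root t (max_norm A t) = 0"
    by (intro eventually_sequentiallyI[of T]) simp
  then have "(\<lambda>t. root t (max_norm A t)) \<longlonglongrightarrow> 0" by (rule tendsto_eventually)
  then show ?thesis using cjsr_limit LIMSEQ_unique by blast
qed

end

section \<open>Characterisation of a vanishing constrained joint spectral radius\<close>

theorem theorem3p1:
  fixes V :: "'v set" and E :: "'v edge set" and N :: nat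
    and A :: "nat \<Rightarrow> real^'n^'n"
  assumes "automaton V E N"
  shows "cjsr V E A = 0 \<longleftrightarrow>
    (\<forall>p. path_in V E p \<and> length p = CARD('n) * card V \<longrightarrow> path_prod A p = 0)"
  using automaton.path_prod_eq_0_of_cjsr_eq_0[OF assms]
    automaton.cjsr_eq_0_of_path_prod_eq_0[OF assms] by blast

end
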